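(* Fix $0<q\le p\le1$. For $\delta>0$ and $k\le n^{1/2-\delta}$ let $\mathcal{Z}$ be the generalized planted bipartite densest subgraph problem with parameters $p,q$. Then for any integer $\ell\le k$, $$\mathrm{SDA}\left(\mathcal{Z},\ \frac{2k^2}{n^2}\left(\left(1+\frac{(p-q)^2}{q(1-q)}\right)^{\ell+1}-1\right),\ \frac{1}{\binom{n}{k}}\right)\ge\frac{n^{2\ell\delta}}{4},$$ provided $n^{2\delta}\ge 1+(p-q)^2/(q(1-q))$.
   Context: For $S\subseteq[n]$ with $|S|=k$, $D_S$ is the distribution on $\{0,1\}^n$ where with probability $1-k/n$ all entries of $x$ are independent Bernoulli with bias $q$, and with probability $k/n$ the $k$ coordinates in $S$ are independent Bernoulli with bias $p$ and the remaining coordinates are independent Bernoulli with bias $q$. The generalized planted bipartite densest $k$-subgraph problem $\mathcal{Z}$ is the search problem with domain $X=\{0,1\}^n$, distribution class $\mathcal{D}=\{D_S:|S|=k\}$, solutions $\mathcal{F}=\{S\subseteq[n]:|S|=k\}$, and $\mathcal{Z}(D_S)=\{S\}$; $\mathcal{Z}^{-1}(f)=\{D\in\mathcal{D}:f\in\mathcal{Z}(D)\}$. For distributions $D_1,D$ over $X$ (with $D(x)=0\Rightarrow D_1(x)=0$), $\frac{D_1}{D}-1$ denotes $x\mapsto D_1(x)/D(x)-1$ on the support of $D$, $\langle f,g\rangle_D=\mathbb{E}_{x\sim D}[f(x)g(x)]$, and for a finite set $\mathcal{D}'$, $\rho(\mathcal{D}',D)=\frac{1}{|\mathcal{D}'|^2}\sum_{D_1,D_2\in\mathcal{D}'}\left|\left\langle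 \frac{D_1}{D}-1,\frac{D_2}{D}-1\right\rangle_D\right|$. $\mathrm{SDA}(\mathcal{Z},\bar{\gamma},\eta)$ is the largest integer $d$ such that there exist a reference distribution $D$ over $X$ and a finite $\mathcal{D}_D\subseteq\mathcal{D}$ such that for every $f\in\mathcal{F}$ the set $\mathcal{D}_f=\mathcal{D}_D\setminus\mathcal{Z}^{-1}(f)$ has size at least $(1-\eta)|\mathcal{D}_D|$ and every $\mathcal{D}'\subseteq\mathcal{D}_f$ with $|\mathcal{D}'|\ge|\mathcal{D}_f|/d$ satisfies $\rho(\mathcal{D}',D)<\bar{\gamma}$.
   Formalization: Proved for q<p, k≥1 and ℓ≥0: if p=q, k=0 or ℓ<0 the threshold is at most 0 (or undefined when q=1), so no d is admissible and the claim fails. SDA is a supremum (possibly infinite) over d≥1, with the family D_D required to be nonempty. *)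

theory Defs
  imports "HOL-Probability.Probability"
begin

record ('a, 'f) search_problem =
  sp_domain :: "'a set"
  sp_dists :: "'a pmf set"
  sp_solutions :: "'f set"
  sp_valid :: "'a pmf \<Rightarrow> 'f set"

definition sp_preimage :: "('a, 'f) search_problem \<Rightarrow> 'f \<Rightarrow> 'a pmf set" where
  "sp_preimage Z f = {D \<in> sp_dists Z. f \<in> sp_valid Z D}"

definition rel_dev :: "'a pmf \<Rightarrow> 'a pmf \<Rightarrow> 'a \<Rightarrow> real" where
  "rel_dev D1 D x = pmf D1 x / pmf D x - 1"

definition inner_pmf :: "'a pmf \<Rightarrow> ('a \<Rightarrow> real) \<Rightarrow> ('a \<Rightarrow> real) \<Rightarrow> real" where
  "inner_pmf D f g = measure_pmf.expectation D (\<lambda>x. f x * g x)"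

definition avg_corr :: "'a pmf set \<Rightarrow> 'a pmf \<Rightarrow> real" where
  "avg_corr DD D =
     1 / (real (card DD))\<^sup>2 *
       (\<Sum>D1\<in>DD. \<Sum>D2\<in>DD. \<bar>inner_pmf D (rel_dev D1 D) (rel_dev D2 D)\<bar>)"

text \<open>
  The family \<open>DD\<close> is required to be nonempty: the average correlation of an empty family is
  0/0, which evaluates to 0, so that an empty \<open>DD\<close> would satisfy the remaining conditions
  for every \<open>d\<close> as soon as \<open>\<gamma> > 0\<close>. The condition \<open>set_pmf D1 \<subseteq> set_pmf D\<close>
  says that \<open>D1\<close> vanishes wherever the reference distribution does.
\<close>

definition sda_bound :: "('a, 'f) search_problem \<Rightarrow> real \<Rightarrow> real \<Rightarrow> nat \<Rightarrow> bool" where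
  "sda_bound Z \<gamma> \<eta> d \<longleftrightarrow>
     (\<exists>D DD. set_pmf D \<subseteq> sp_domain Z \<and>
        finite DD \<and> DD \<noteq> {} \<and> DD \<subseteq> sp_dists Z \<and>
        (\<forall>D1\<in>DD. set_pmf D1 \<subseteq> set_pmf D) \<and>
        (\<forall>f\<in>sp_solutions Z.
           real (card (DD - sp_preimage Z f)) \<ge> (1 - \<eta>) * real (card DD) \<and>
           (\<forall>D' \<subseteq> DD - sp_preimage Z f.
              real (card D') \<ge> real (card (DD - sp_preimage Z f)) / real d \<longrightarrow>
              avg_corr D' D < \<gamma>)))"

text \<open>
  The largest admissible positive \<open>d\<close>. The supremum is taken in \<^typ>\<open>enat\<close> because for large
  \<open>\<gamma>\<close> every \<open>d\<close> is admissible; the value is then \<open>\<infinity>\<close>.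
\<close>

definition SDA :: "('a, 'f) search_problem \<Rightarrow> real \<Rightarrow> real \<Rightarrow> enat" where
  "SDA Z \<gamma> \<eta> = Sup {enat d | d. d \<ge> 1 \<and> sda_bound Z \<gamma> \<eta> d}"

text \<open>
  A point of \<open>{0,1}\<^sup>n\<close> is a function \<^typ>\<open>nat \<Rightarrow> bool\<close> that is \<^const>\<open>False\<close> outside \<open>{1..n}\<close>.
\<close>

definition cube :: "nat \<Rightarrow> (nat \<Rightarrow> bool) set" where
  "cube n = PiE_dflt {1..n} False (\<lambda>_. UNIV)"

definition planted_dist ::
    "nat \<Rightarrow> nat \<Rightarrow> real \<Rightarrow> real \<Rightarrow> nat set \<Rightarrow> (nat \<Rightarrow> bool) pmf" where
  "planted_dist n k p q S =
     bind_pmf (bernoulli_pmf (real k / real n))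
       (\<lambda>b. Pi_pmf {1..n} False
              (\<lambda>i. bernoulli_pmf (if b \<and> i \<in> S then p else q)))"

definition ksubsets :: "nat \<Rightarrow> nat \<Rightarrow> nat set set" where
  "ksubsets n k = {S. S \<subseteq> {1..n} \<and> card S = k}"

definition planted_bds ::
    "nat \<Rightarrow> nat \<Rightarrow> real \<Rightarrow> real \<Rightarrow> (nat \<Rightarrow> bool, nat set) search_problem" where
  "planted_bds n k p q =
     \<lparr> sp_domain = cube n,
       sp_dists = planted_dist n k p q ` ksubsets n k,
       sp_solutions = ksubsets n k,
       sp_valid = (\<lambda>D. {S \<in> ksubsets n k. D = planted_dist n k p q S}) \<rparr>"

lemma planted_dist_marginal:
  assumes "i \<in> {1..n}" "k \<le> n" "0 \<le> q" "q \<le> 1" "0 \<le> p" "p \<le> 1"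
  shows "pmf (map_pmf (\<lambda>x. x i) (planted_dist n k p q S)) True =
           (if i \<in> S then q + real k / real n * (p - q) else q)"
proof -
  have "map_pmf (\<lambda>x. x i) (planted_dist n k p q S) =
      bind_pmf (bernoulli_pmf (real k / real n))
        (\<lambda>b. bernoulli_pmf (if b \<and> i \<in> S then p else q))"
    using assms(1) by (simp add: planted_dist_def map_bind_pmf Pi_pmf_component)
  moreover have "0 \<le> real k / real n" "real k / real n \<le> 1"
    using assms by (auto simp: divide_le_eq_1)
  ultimately show ?thesis
    using assms by (simp add: pmf_bind algebra_simps diff_divide_distrib)
qed

lemma sp_valid_planted_bds:
  assumes "S \<in> ksubsets n k" "1 \<le> k" "0 \<le> q" "q < p" "p \<le> 1"
  shows "sp_valid (planted_bds n k p q) (planted_dist n k p q S) = {S}"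
proof -
  have kn: "k \<le> n"
    using assms(1) card_mono[of "{1..n}" S] by (auto simp: ksubsets_def)
  have "S = T" if T: "T \<in> ksubsets n k"
    and eq: "planted_dist n k p q S = planted_dist n k p q T" for T
  proof -
    have pos: "real k / real n * (p - q) > 0"
      using assms kn by simp
    have "i \<in> S \<longleftrightarrow> i \<in> T" if "i \<in> {1..n}" for i
      using planted_dist_marginal[OF that kn, of q p S]
        planted_dist_marginal[OF that kn, of q p T] pos assms eq
      by (auto split: if_splits)
    then show ?thesis using T assms(1) by (auto simp: ksubsets_def)
  qed
  then show ?thesis using assms(1) by (auto simp: planted_bds_def)
qed

lemma set_pmf_planted_dist: "set_pmf (planted_dist n k p q S) \<subseteq> cube n"
  by (auto simp: planted_dist_def cube_def set_Pi_pmf PiE_dflt_def)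

end

theory Submission
  imports Defs
begin

text \<open>
  Take the product distribution of bias \<open>q\<close> as reference. The likelihood ratio of the planted
  part against it is a product over the planted set, so with \<open>c = 1 + (p - q)\<^sup>2 / (q (1 - q))\<close>
  the correlation of \<open>D\<^sub>S\<close> and \<open>D\<^sub>T\<close> is \<open>(k/n)\<^sup>2 (c\<^bsup>|S \<inter> T|\<^esup> - 1)\<close>.
  Put \<open>N = n\<^bsup>2\<delta>\<^esup>\<close> and \<open>m = (n choose k)\<close>. A union bound over the \<open>j\<close>-subsets of \<open>S\<close> and
  \<open>k\<^sup>2 N \<le> n\<close> show that at most \<open>m N\<^bsup>-j\<^esup> / j!\<close> sets \<open>T\<close> meet \<open>S\<close> in \<open>j\<close> points.
  Pairs with \<open>|S \<inter> T| \<le> l + 1\<close> contribute on average at most \<open>c\<^bsup>l+1\<^esup> - 1\<close>; since \<open>c \<le> N\<close>,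
  the total excess \<open>c\<^bsup>j\<^esup> - c\<^bsup>l+1\<^esup>\<close> over larger intersections is dominated by the telescoping
  series of \<open>(j - 1) / j!\<close>, and it is less than \<open>c\<^bsup>l+1\<^esup> - 1\<close> per member of any family of at
  least \<open>(m - 1) / N\<^bsup>l\<^esup>\<close> sets.
\<close>

section \<open>Subsets with prescribed intersection size\<close>

lemma finite_ksubsets: "finite (ksubsets n k)"
  by (rule finite_subset[of _ "Pow {1..n}"]) (auto simp: ksubsets_def)

lemma card_ksubsets: "card (ksubsets n k) = n choose k"
  unfolding ksubsets_def using n_subsets[of "{1..n}" k] by simp

text \<open>The quotient of the binomials is the product of \<open>(k - i) / (n - i)\<close> over
  \<open>i < j\<close>, and each factor is at most \<open>k / n\<close>.\<close>

lemma binomial_diff_diff_le_power: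
  assumes "j \<le> k" "k \<le> n"
  shows "((n - j) choose (k - j)) * n ^ j \<le> k ^ j * (n choose k)"
  using assms(1)
proof (induction j)
  case 0
  then show ?case by simp
next
  case (Suc j)
  let ?B = "(n - j) choose (k - j)" and ?B' = "(n - Suc j) choose (k - Suc j)"
  have absorb: "(k - j) * ?B = (n - j) * ?B'"
    using times_binomial_minus1_eq[of "k - j" "n - j"] Suc.prems by simp
  have ratio: "(k - j) * n \<le> k * (n - j)"
    using assms(2)
    by (simp add: diff_mult_distrib diff_mult_distrib2 mult.commute diff_le_mono2)
  have "(n - j) * (?B' * n ^ Suc j) = ((n - j) * ?B') * n * n ^ j"
    by (simp add: mult_ac)
  also have "\<dots> = ((k - j) * n) * (?B * n ^ j)"
    unfolding absorb[symmetric] by (simp add: mult_ac)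
  also have "\<dots> \<le> (k * (n - j)) * (k ^ j * (n choose k))"
    using Suc.prems by (intro mult_le_mono ratio Suc.IH) simp
  also have "\<dots> = (n - j) * (k ^ Suc j * (n choose k))"
    by (simp add: mult_ac)
  finally show ?case
    using Suc.prems assms(2) by simp
qed

lemma card_ksubsets_superset:
  assumes "J \<subseteq> {1..n}" "card J \<le> k"
  shows "card {T \<in> ksubsets n k. J \<subseteq> T} = (n - card J) choose (k - card J)"
proof -
  have finJ: "finite J"
    using assms(1) by (rule finite_subset) simp
  have "bij_betw (\<lambda>T. T - J) {T \<in> ksubsets n k. J \<subseteq> T}
          {U. U \<subseteq> {1..n} - J \<and> card U = k - card J}"
  proof (rule bij_betw_byWitness[where f' = "\<lambda>U. U \<union> J"])
    show "(\<lambda>T. T - J) ` {T \<in> ksubsets n k. J \<subseteq> T}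
        \<subseteq> {U. U \<subseteq> {1..n} - J \<and> card U = k - card J}"
      using finJ by (auto simp: ksubsets_def card_Diff_subset)
    show "(\<lambda>U. U \<union> J) ` {U. U \<subseteq> {1..n} - J \<and> card U = k - card J}
        \<subseteq> {T \<in> ksubsets n k. J \<subseteq> T}"
    proof safe
      fix U assume U: "U \<subseteq> {1..n} - J" "card U = k - card J"
      have "finite U"
        using U(1) by (rule finite_subset) simp
      then have "card (U \<union> J) = k"
        using U assms(2) finJ by (subst card_Un_disjoint) auto
      then show "U \<union> J \<in> ksubsets n k"
        using U assms(1) by (auto simp: ksubsets_def)
    qed
  qed auto
  then have "card {T \<in> ksubsets n k. J \<subseteq> T}
      = card {U. U \<subseteq> {1..n} - J \<and> card U = k - card J}"
    by (rule bij_betw_same_card)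
  also have "\<dots> = card ({1..n} - J) choose (k - card J)"
    by (rule n_subsets) simp
  also have "card ({1..n} - J) = n - card J"
    using assms(1) finJ by (simp add: card_Diff_subset)
  finally show ?thesis .
qed

text \<open>Each such \<open>T\<close> contains a \<open>j\<close>-subset \<open>J\<close> of
  \<open>S\<close>. One factor \<open>k ^ j\<close> bounds \<open>(k choose j) * fact j\<close>; the
  other, over \<open>n ^ j\<close>, bounds the share of \<open>k\<close>-subsets containing
  \<open>J\<close>.\<close>

lemma card_ksubsets_inter_le:
  assumes S: "S \<in> ksubsets n k" and "j \<le> k" "k \<le> n" "1 \<le> n"
  shows "real (card {T \<in> ksubsets n k. card (S \<inter> T) = j})
           \<le> real (n choose k) * ((real k)\<^sup>2 / real n) ^ j / fact j"
proof -
  have finS: "finite S" and SS: "S \<subseteq> {1..n}" "card S = k"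
    using S finite_subset[of S "{1..n}"] by (auto simp: ksubsets_def)
  let ?I = "{J. J \<subseteq> S \<and> card J = j}"
  have finI: "finite ?I"
    using finS by simp
  have "card {T \<in> ksubsets n k. card (S \<inter> T) = j}
      \<le> card (\<Union>J\<in>?I. {T \<in> ksubsets n k. J \<subseteq> T})"
    using finI finite_ksubsets by (intro card_mono) auto
  also have "\<dots> \<le> (\<Sum>J\<in>?I. card {T \<in> ksubsets n k. J \<subseteq> T})"
    using finI by (rule card_UN_le)
  also have "\<dots> = (\<Sum>J\<in>?I. (n - j) choose (k - j))"
    using SS assms by (intro sum.cong refl) (auto simp: card_ksubsets_superset)
  also have "\<dots> = (k choose j) * ((n - j) choose (k - j))"
    using n_subsets[OF finS, of j] SS by simp
  finally have "card {T \<in> ksubsets n k. card (S \<inter> T) = j}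
      \<le> (k choose j) * ((n - j) choose (k - j))" .
  then have "card {T \<in> ksubsets n k. card (S \<inter> T) = j} * (fact j * n ^ j)
      \<le> ((k choose j) * ((n - j) choose (k - j))) * (fact j * n ^ j)"
    by (rule mult_right_mono) simp
  also have "\<dots> = ((k choose j) * fact j) * (((n - j) choose (k - j)) * n ^ j)"
    by (simp add: mult_ac)
  also have "\<dots> \<le> k ^ j * (k ^ j * (n choose k))"
    using assms by (intro mult_mono binomial_fact_pow binomial_diff_diff_le_power) auto
  finally have "real (card {T \<in> ksubsets n k. card (S \<inter> T) = j} * (fact j * n ^ j))
      \<le> real (k ^ j * (k ^ j * (n choose k)))"
    by (simp only: of_nat_le_iff)
  then show ?thesis
    using assms(4)
    by (simp add: field_simps power_divide power2_eq_square power_mult_distrib)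
qed

section \<open>The tail of the intersection distribution\<close>

text \<open>The left side is \<open>c - 1\<close> times a geometric sum of \<open>Suc i\<close>
  terms, each at most \<open>c ^ i\<close>.\<close>

lemma power_Suc_minus_one_le:
  fixes c :: real
  assumes "1 \<le> c"
  shows "c ^ Suc i - 1 \<le> (c - 1) * real (Suc i) * c ^ i"
proof (induction i)
  case 0
  then show ?case by simp
next
  case (Suc i)
  have "c ^ Suc (Suc i) - 1 = c * (c ^ Suc i - 1) + (c - 1)"
    by (simp add: algebra_simps)
  also have "\<dots> \<le> c * ((c - 1) * real (Suc i) * c ^ i) + (c - 1) * c ^ Suc i"
    using assms Suc one_le_power[OF assms, of "Suc i"]
    by (intro add_mono mult_left_mono) (auto simp: mult_le_cancel_left1)
  also have "\<dots> = (c - 1) * real (Suc (Suc i)) * c ^ Suc i"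
    by (simp add: algebra_simps)
  finally show ?case .
qed

text \<open>Telescoping: \<open>(j - 1) / j!\<close> equals
  \<open>1 / (j - 1)! - 1 / j!\<close>.\<close>

lemma sum_pred_over_fact:
  assumes "1 \<le> k"
  shows "(\<Sum>j=2..k. (real j - 1) / fact j) = 1 - 1 / fact k"
  using assms
proof (induction k rule: dec_induct)
  case base
  then show ?case by simp
next
  case (step k)
  have "(\<Sum>j=2..Suc k. (real j - 1) / fact j)
      = (\<Sum>j=2..k. (real j - 1) / fact j) + real k / fact (Suc k)"
    using step.hyps by simp
  also have "\<dots> = 1 - 1 / fact k + real k / fact (Suc k)"
    by (simp only: step.IH)
  also have "\<dots> = 1 - 1 / fact (Suc k)"
    by (simp add: divide_simps) (simp add: algebra_simps)
  finally show ?case .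
qed

text \<open>For \<open>j = l + 2 + i\<close> the bound \<open>c ^ i \<le> N ^ i\<close> cancels all
  of \<open>N ^ j\<close> except \<open>N ^ (l + 2)\<close>. The deficit \<open>1 / fact k\<close>
  is kept for \<open>sum_power_inter_excess_le\<close>.\<close>

lemma sum_tail_over_fact_le:
  fixes c N :: real
  assumes "1 \<le> c" "c \<le> N" "1 \<le> k"
  shows "(\<Sum>j=l+2..k. (c ^ j - c ^ (l + 1)) / (N ^ j * fact j))
           \<le> (c - 1) * c ^ (l + 1) / N ^ (l + 2) * (1 - 1 / fact k)"
proof -
  let ?K = "(c - 1) * c ^ (l + 1) / N ^ (l + 2)"
  have N: "N > 0" using assms by simp
  have K: "?K \<ge> 0" using assms N by simp
  have le: "(c ^ j - c ^ (l + 1)) / (N ^ j * fact j) \<le> ?K * ((real j - 1) / fact j)"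
    if "j \<in> {l+2..k}" for j
  proof -
    obtain i where j: "j = l + 2 + i"
      using \<open>j \<in> {l+2..k}\<close> by (metis atLeastAtMost_iff le_Suc_ex)
    have "c ^ j - c ^ (l + 1) = c ^ (l + 1) * (c ^ Suc i - 1)"
      by (simp add: j power_add algebra_simps)
    also have "\<dots> \<le> c ^ (l + 1) * ((c - 1) * real (Suc i) * c ^ i)"
      using assms by (intro mult_left_mono power_Suc_minus_one_le) auto
    \<comment> \<open>Besides using \<open>c \<le> N\<close>, this weakens
      \<open>i + 1 = j - l - 1\<close> to \<open>j - 1\<close>, the numerator that
      telescopes.\<close>
    also have "\<dots> \<le> c ^ (l + 1) * ((c - 1) * (real j - 1) * N ^ i)"
      using assms by (intro mult_left_mono mult_mono power_mono) (auto simp: j)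
    also have "\<dots> = ?K * (real j - 1) * N ^ j"
      using N by (simp add: j power_add)
    finally have "(c ^ j - c ^ (l + 1)) / N ^ j \<le> ?K * (real j - 1)"
      using N by (subst pos_divide_le_eq) auto
    then have "(c ^ j - c ^ (l + 1)) / N ^ j / fact j \<le> ?K * (real j - 1) / fact j"
      by (rule divide_right_mono) simp
    then show ?thesis by simp
  qed
  have "(\<Sum>j=l+2..k. (c ^ j - c ^ (l + 1)) / (N ^ j * fact j))
      \<le> (\<Sum>j=l+2..k. ?K * ((real j - 1) / fact j))"
    by (rule sum_mono) (rule le)
  also have "\<dots> = ?K * (\<Sum>j=l+2..k. (real j - 1) / fact j)"
    by (rule sum_distrib_left[symmetric])
  also have "\<dots> \<le> ?K * (\<Sum>j=2..k. (real j - 1) / fact j)"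
    using K by (intro mult_left_mono sum_mono2) auto
  finally show ?thesis
    using sum_pred_over_fact[OF assms(3)] by simp
qed

text \<open>Grouping by intersection size reduces this to the tail series. The last factor is the
  number of distributions left once one solution is excluded, ready for comparison with family
  sizes.\<close>

lemma sum_power_inter_excess_le:
  fixes c N :: real
  assumes S: "S \<in> ksubsets n k" and "1 \<le> k" "k \<le> n"
    and c: "1 \<le> c" "c \<le> N" and kN: "(real k)\<^sup>2 * N \<le> real n"
  shows "(\<Sum>T | T \<in> ksubsets n k \<and> l + 2 \<le> card (S \<inter> T). c ^ card (S \<inter> T) - c ^ (l + 1))
           \<le> (c - 1) * c ^ (l + 1) / N ^ (l + 2) * (real (n choose k) - 1)"
    (is "sum ?f ?A \<le> ?K * _")
proof -
  let ?m = "real (n choose k)"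
  have N: "N > 0" "1 \<le> N" using c by auto
  have K: "?K \<ge> 0" using c N by simp
  have finS: "finite S" and SS: "S \<subseteq> {1..n}" "card S = k"
    using S finite_subset[of S "{1..n}"] by (auto simp: ksubsets_def)
  have fin: "finite ?A"
    using finite_ksubsets by simp
  have range: "(\<lambda>T. card (S \<inter> T)) ` ?A \<subseteq> {l+2..k}"
    using finS SS by (auto intro!: card_mono)
  have layer: "card {T \<in> ksubsets n k. card (S \<inter> T) = j} \<le> ?m / (N ^ j * fact j)"
    if "j \<le> k" for j
  proof -
    have "(real k)\<^sup>2 / real n \<le> 1 / N"
      using kN N assms by (simp add: field_simps)
    then have "((real k)\<^sup>2 / real n) ^ j \<le> (1 / N) ^ j"
      by (intro power_mono) auto
    then have "?m * ((real k)\<^sup>2 / real n) ^ j / fact j \<le> ?m * (1 / N) ^ j / fact j"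
      by (intro divide_right_mono mult_left_mono) auto
    with card_ksubsets_inter_le[OF S that] assms show ?thesis
      by (simp add: power_divide)
  qed
  have "sum ?f ?A = (\<Sum>j=l+2..k. sum ?f {T. T \<in> ?A \<and> card (S \<inter> T) = j})"
    by (rule sum.group[symmetric]) (use fin range in auto)
  also have "\<dots> \<le> (\<Sum>j=l+2..k. ?m * ((c ^ j - c ^ (l + 1)) / (N ^ j * fact j)))"
  proof (rule sum_mono)
    fix j assume j: "j \<in> {l+2..k}"
    have set_eq: "{T. T \<in> ?A \<and> card (S \<inter> T) = j} = {T \<in> ksubsets n k. card (S \<inter> T) = j}"
      using j by auto
    have "sum ?f {T. T \<in> ?A \<and> card (S \<inter> T) = j}
        = real (card {T \<in> ksubsets n k. card (S \<inter> T) = j}) * (c ^ j - c ^ (l + 1))"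
      unfolding set_eq by simp
    also have "\<dots> \<le> ?m / (N ^ j * fact j) * (c ^ j - c ^ (l + 1))"
      using j c by (intro mult_right_mono layer) (auto intro!: power_increasing simp flip: power_Suc)
    finally show "sum ?f {T. T \<in> ?A \<and> card (S \<inter> T) = j}
        \<le> ?m * ((c ^ j - c ^ (l + 1)) / (N ^ j * fact j))"
      by simp
  qed
  also have "\<dots> = ?m * (\<Sum>j=l+2..k. (c ^ j - c ^ (l + 1)) / (N ^ j * fact j))"
    by (rule sum_distrib_left[symmetric])
  also have "\<dots> \<le> ?m * (?K * (1 - 1 / fact k))"
    using c \<open>1 \<le> k\<close> by (intro mult_left_mono sum_tail_over_fact_le) auto
  also have "\<dots> = ?K * (?m - ?m / fact k)"
    by (simp add: algebra_simps)
  \<comment> \<open>\<open>k! \<le> k\<^sup>k \<le> (n/k)\<^sup>k \<le> m\<close>: truncating the telescoping sum at \<open>k\<close> pays for the one excluded set.\<close>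
  also have "\<dots> \<le> ?K * (?m - 1)"
  proof -
    have "(real k)\<^sup>2 \<le> (real k)\<^sup>2 * N"
      using N by (simp add: mult_le_cancel_left1)
    also note kN
    finally have "real k \<le> real n / real k"
      using \<open>1 \<le> k\<close> by (simp add: field_simps power2_eq_square)
    then have "real k ^ k \<le> (real n / real k) ^ k"
      by (intro power_mono) auto
    also have "\<dots> \<le> ?m"
      using \<open>k \<le> n\<close> by (rule binomial_ge_n_over_k_pow_k)
    finally have "real k ^ k \<le> ?m" .
    with fact_le_power[of k, where 'a = real] have "fact k \<le> ?m"
      unfolding of_nat_power by (rule order_trans)
    then have "1 \<le> ?m / fact k" by simp
    then show ?thesis using K by (intro mult_left_mono) auto
  qed
  finally show ?thesis .
qed

section \<open>Correlations relative to the uniform-bias product distribution\<close>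

definition null_dist :: "nat \<Rightarrow> real \<Rightarrow> (nat \<Rightarrow> bool) pmf" where
  "null_dist n q = Pi_pmf {1..n} False (\<lambda>_. bernoulli_pmf q)"

text \<open>Likelihood ratio of the fully planted product distribution against
  \<open>null_dist\<close>. The factors 1 outside \<open>S\<close> let the product run over all
  coordinates, so that expectations factorize.\<close>

definition lratio :: "nat \<Rightarrow> real \<Rightarrow> real \<Rightarrow> nat set \<Rightarrow> (nat \<Rightarrow> bool) \<Rightarrow> real" where
  "lratio n p q S x =
     (\<Prod>i\<in>{1..n}. if i \<in> S then (if x i then p / q else (1 - p) / (1 - q)) else 1)"

lemma set_pmf_null_dist:
  assumes "0 < q" "q < 1"
  shows "set_pmf (null_dist n q) = cube n"
  using assms by (auto simp: null_dist_def cube_def set_Pi_pmf PiE_dflt_def set_pmf_bernoulli)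

lemma finite_cube: "finite (cube n)"
  unfolding cube_def by (rule finite_PiE_dflt) auto

text \<open>With null mass \<open>P\<close> and likelihood ratio \<open>L\<close>, the mixture is
  \<open>(1 - k/n) * P + (k/n) * P * L\<close>.\<close>

lemma pmf_planted_dist:
  assumes "0 < q" "q < 1" "0 \<le> p" "p \<le> 1" "k \<le> n" "x \<in> cube n"
  shows "pmf (planted_dist n k p q S) x =
           pmf (null_dist n q) x * (1 + real k / real n * (lratio n p q S x - 1))"
proof -
  have kn: "0 \<le> real k / real n" "real k / real n \<le> 1"
    using assms by (auto simp: divide_le_eq_1)
  have x: "\<And>i. i \<notin> {1..n} \<Longrightarrow> x i = False"
    using assms(6) by (auto simp: cube_def PiE_dflt_def)
  have "pmf (Pi_pmf {1..n} False (\<lambda>i. bernoulli_pmf (if i \<in> S then p else q))) x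
      = (\<Prod>i\<in>{1..n}. pmf (bernoulli_pmf (if i \<in> S then p else q)) (x i))"
    by (rule pmf_Pi') (use x in auto)
  also have "\<dots> = (\<Prod>i\<in>{1..n}. pmf (bernoulli_pmf q) (x i) *
      (if i \<in> S then (if x i then p / q else (1 - p) / (1 - q)) else 1))"
    by (rule prod.cong) (use assms in \<open>auto split: if_splits\<close>)
  also have "\<dots> = (\<Prod>i\<in>{1..n}. pmf (bernoulli_pmf q) (x i)) * lratio n p q S x"
    by (simp only: prod.distrib lratio_def)
  also have "(\<Prod>i\<in>{1..n}. pmf (bernoulli_pmf q) (x i)) = pmf (null_dist n q) x"
    unfolding null_dist_def by (rule pmf_Pi'[symmetric]) (use x in auto)
  finally have "pmf (Pi_pmf {1..n} False (\<lambda>i. bernoulli_pmf (if i \<in> S then p else q))) x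
      = pmf (null_dist n q) x * lratio n p q S x" .
  then show ?thesis
    using kn by (simp add: planted_dist_def pmf_bind null_dist_def algebra_simps)
qed

lemma rel_dev_planted_dist:
  assumes "0 < q" "q < 1" "0 \<le> p" "p \<le> 1" "k \<le> n" "x \<in> cube n"
  shows "rel_dev (planted_dist n k p q S) (null_dist n q) x =
           real k / real n * (lratio n p q S x - 1)"
proof -
  have "pmf (null_dist n q) x \<noteq> 0"
    using set_pmf_null_dist[OF assms(1,2), of n] assms(6) by (auto simp: set_pmf_iff)
  then show ?thesis
    using pmf_planted_dist[OF assms] by (simp add: rel_dev_def)
qed

text \<open>By independence the expectation factorizes, and a coordinate in \<open>S\<close> has
  mean \<open>q * (p / q) + (1 - q) * ((1 - p) / (1 - q)) = 1\<close>.\<close>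

lemma expectation_lratio:
  assumes "0 < q" "q < 1" "0 \<le> p" "p \<le> 1"
  shows "measure_pmf.expectation (null_dist n q) (lratio n p q S) = 1"
proof -
  have "measure_pmf.expectation (null_dist n q) (lratio n p q S) =
      (\<Prod>i\<in>{1..n}. measure_pmf.expectation (bernoulli_pmf q)
         (\<lambda>b. if i \<in> S then (if b then p / q else (1 - p) / (1 - q)) else 1))"
    unfolding lratio_def null_dist_def
    by (rule expectation_prod_Pi_pmf)
      (use assms in \<open>auto intro!: integrable_measure_pmf_finite\<close>)
  also have "\<dots> = 1"
    by (rule prod.neutral) (use assms in auto)
  finally show ?thesis .
qed

text \<open>Coordinates outside \<open>S \<inter> T\<close> have mean 1. Each common one gives the
  second moment of its ratio: 1 plus the chi-square divergence of Bernoulli \<open>p\<close> from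
  Bernoulli \<open>q\<close>.\<close>

lemma expectation_lratio_mult:
  assumes "0 < q" "q < 1" "0 \<le> p" "p \<le> 1" "S \<subseteq> {1..n}"
  shows "measure_pmf.expectation (null_dist n q) (\<lambda>x. lratio n p q S x * lratio n p q T x)
           = (1 + (p - q)\<^sup>2 / (q * (1 - q))) ^ card (S \<inter> T)"
proof -
  let ?h = "\<lambda>b. if b then p / q else (1 - p) / (1 - q)"
  let ?c = "1 + (p - q)\<^sup>2 / (q * (1 - q))"
  have "measure_pmf.expectation (null_dist n q) (\<lambda>x. lratio n p q S x * lratio n p q T x) =
      (\<Prod>i\<in>{1..n}. measure_pmf.expectation (bernoulli_pmf q)
         (\<lambda>b. (if i \<in> S then ?h b else 1) * (if i \<in> T then ?h b else 1)))"
    unfolding lratio_def null_dist_def prod.distrib[symmetric]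
    by (rule expectation_prod_Pi_pmf)
      (use assms in \<open>auto intro!: integrable_measure_pmf_finite\<close>)
  also have "\<dots> = (\<Prod>i\<in>{1..n}. if i \<in> S \<inter> T then ?c else 1)"
  proof (rule prod.cong[OF refl])
    fix i
    have "p * p / q + (1 - p) * (1 - p) / (1 - q) = ?c"
      using assms by (simp add: field_simps power2_eq_square)
    then show "measure_pmf.expectation (bernoulli_pmf q)
         (\<lambda>b. (if i \<in> S then ?h b else 1) * (if i \<in> T then ?h b else 1))
         = (if i \<in> S \<inter> T then ?c else 1)"
      using assms by auto
  qed
  also have "\<dots> = (\<Prod>i\<in>S \<inter> T. ?c)"
    using assms(5) by (intro prod.mono_neutral_cong_right) auto
  finally show ?thesis by simp
qed

text \<open>Both ratios have mean 1, so their covariance is the mean of the product minus 1; the two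
  mixture weights \<open>k/n\<close> form the prefactor.\<close>

lemma inner_pmf_planted_dist:
  assumes "0 < q" "q < 1" "0 \<le> p" "p \<le> 1" "k \<le> n" "S \<subseteq> {1..n}"
  shows "inner_pmf (null_dist n q)
           (rel_dev (planted_dist n k p q S) (null_dist n q))
           (rel_dev (planted_dist n k p q T) (null_dist n q))
         = (real k)\<^sup>2 / (real n)\<^sup>2 * ((1 + (p - q)\<^sup>2 / (q * (1 - q))) ^ card (S \<inter> T) - 1)"
proof -
  let ?D = "null_dist n q" and ?L = "lratio n p q"
  have int: "integrable ?D f" for f :: "_ \<Rightarrow> real"
    by (rule integrable_measure_pmf_finite) (simp add: set_pmf_null_dist assms finite_cube)
  \<comment> \<open>The formula for \<open>rel_dev\<close> is available on the support of the
    reference only, hence almost everywhere.\<close>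
  have "inner_pmf ?D (rel_dev (planted_dist n k p q S) ?D) (rel_dev (planted_dist n k p q T) ?D)
      = measure_pmf.expectation ?D
          (\<lambda>x. (real k)\<^sup>2 / (real n)\<^sup>2 * (?L S x * ?L T x - ?L S x - ?L T x + 1))"
    unfolding inner_pmf_def
    by (intro integral_cong_AE)
      (auto simp: AE_measure_pmf_iff set_pmf_null_dist rel_dev_planted_dist assms
        power2_eq_square algebra_simps)
  also have "\<dots> = (real k)\<^sup>2 / (real n)\<^sup>2 *
      (measure_pmf.expectation ?D (\<lambda>x. ?L S x * ?L T x)
        - measure_pmf.expectation ?D (?L S) - measure_pmf.expectation ?D (?L T) + 1)"
    by (simp add: int)
  finally show ?thesis
    using assms by (simp add: expectation_lratio expectation_lratio_mult)
qed

section \<open>The statistical dimension\<close>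

text \<open>Lets sums and cardinalities over distributions be computed over subsets.\<close>

lemma inj_on_planted_dist:
  assumes "1 \<le> k" "0 \<le> q" "q < p" "p \<le> 1"
  shows "inj_on (planted_dist n k p q) (ksubsets n k)"
  by (rule inj_onI) (metis sp_valid_planted_bds assms singleton_inject)

lemma sp_preimage_planted_bds:
  assumes "S \<in> ksubsets n k"
  shows "sp_preimage (planted_bds n k p q) S = {planted_dist n k p q S}"
  using assms by (auto simp: sp_preimage_def planted_bds_def)

lemma avg_corr_planted_dist_less:
  fixes p q c N :: real and n k l d :: nat
  defines "c \<equiv> 1 + (p - q)\<^sup>2 / (q * (1 - q))"
  assumes pq: "0 < q" "q < p" "p \<le> 1" and k: "1 \<le> k" "k \<le> n"
    and cN: "c \<le> N" and kN: "(real k)\<^sup>2 * N \<le> real n"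
    and d: "1 \<le> d" "real d \<le> N ^ l"
    and A: "A \<subseteq> ksubsets n k" "A \<noteq> {}" "real ((n choose k) - 1) / real d \<le> real (card A)"
  shows "avg_corr (planted_dist n k p q ` A) (null_dist n q)
           < 2 * (real k)\<^sup>2 / (real n)\<^sup>2 * (c ^ (l + 1) - 1)"
proof -
  have q1: "q < 1" using pq by simp
  have c1: "c > 1"
    unfolding c_def using pq q1 by simp
  have N: "N > 1" using c1 cN by simp
  have finA: "finite A"
    using A(1) finite_ksubsets by (rule finite_subset)
  have cardA: "card A > 0"
    using finA A(2) by (simp add: card_gt_0_iff)
  have m: "real ((n choose k) - 1) = real (n choose k) - 1"
    using k zero_less_binomial[of k n] by (simp add: of_nat_diff Suc_le_eq)
  \<comment> \<open>Source of the factor 2: one share \<open>c ^ (l + 1) - 1\<close> per member is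
    the truncated part, the other pays for the excess of large intersections.\<close>
  have row: "(\<Sum>T\<in>A. c ^ card (S \<inter> T) - 1) < 2 * (c ^ (l + 1) - 1) * card A"
    if "S \<in> A" for S
  proof -
    let ?B = "{T. T \<in> ksubsets n k \<and> l + 2 \<le> card (S \<inter> T)}"
    let ?f = "\<lambda>T. c ^ card (S \<inter> T) - c ^ (l + 1)"
    have S: "S \<in> ksubsets n k" using that A by auto
    have "(\<Sum>T\<in>A. c ^ card (S \<inter> T) - 1)
        \<le> (\<Sum>T\<in>A. (c ^ (l + 1) - 1) + (if T \<in> ?B then ?f T else 0))"
    proof (rule sum_mono)
      fix T assume "T \<in> A"
      then have "T \<in> ksubsets n k" using A by auto
      moreover have "c ^ card (S \<inter> T) \<le> c ^ (l + 1)" if "\<not> l + 2 \<le> card (S \<inter> T)"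
        using that c1 by (intro power_increasing) auto
      ultimately show "c ^ card (S \<inter> T) - 1
          \<le> (c ^ (l + 1) - 1) + (if T \<in> ?B then ?f T else 0)"
        by auto
    qed
    also have "\<dots> = (c ^ (l + 1) - 1) * card A + sum ?f (A \<inter> ?B)"
      using finA by (simp only: sum.distrib sum.inter_restrict) simp
    \<comment> \<open>After extending to all \<open>k\<close>-subsets, only the size of
      \<open>A\<close> matters.\<close>
    also have "sum ?f (A \<inter> ?B) \<le> sum ?f ?B"
      using finite_ksubsets c1 by (intro sum_mono2) (auto intro!: power_increasing simp flip: power_Suc)
    also have "sum ?f ?B \<le> (c - 1) * c ^ (l + 1) / N ^ (l + 2) * (real (n choose k) - 1)"
      using S k c1 cN kN by (intro sum_power_inter_excess_le) auto
    also have "\<dots> \<le> (c - 1) * c ^ (l + 1) / N ^ (l + 2) * (card A * N ^ l)"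
    proof (rule mult_left_mono)
      have "real (n choose k) - 1 \<le> card A * real d"
        using A(3) d(1) unfolding m by (simp add: field_simps)
      also have "\<dots> \<le> card A * N ^ l"
        using d(2) by (intro mult_left_mono) auto
      finally show "real (n choose k) - 1 \<le> card A * N ^ l" .
    qed (use c1 N in auto)
    \<comment> \<open>Of the two factors \<open>1 / N\<close> that remain, one absorbs the surplus
      \<open>c\<close> and the other makes the bound strict.\<close>
    also have "\<dots> = ((c - 1) * c ^ l) * (c / N) * (1 / N) * card A"
      using N by (simp add: field_simps)
    also have "\<dots> \<le> (c ^ (l + 1) - 1) * 1 * (1 / N) * card A"
    proof (intro mult_right_mono mult_mono)
      show "(c - 1) * c ^ l \<le> c ^ (l + 1) - 1"
        using one_le_power[of c l] c1 by (simp add: algebra_simps)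
      show "0 \<le> c ^ (l + 1) - 1"
        using one_le_power[of c "l + 1"] c1 by simp
    qed (use c1 cN N in auto)
    also have "\<dots> < (c ^ (l + 1) - 1) * card A"
    proof -
      have "c ^ (l + 1) - 1 > 0"
        using one_less_power[of c "l + 1"] c1 by simp
      then show ?thesis
        using N cardA by (simp add: divide_less_eq)
    qed
    finally show ?thesis by (simp add: algebra_simps)
  qed
  let ?r = "(real k)\<^sup>2 / (real n)\<^sup>2"
  have r: "?r > 0" using k by simp
  let ?P = "planted_dist n k p q" and ?D = "null_dist n q"
  have inj: "inj_on ?P A"
    using inj_on_planted_dist[of k q p n] pq k A(1) inj_on_subset by auto
  have "(\<Sum>D1\<in>?P ` A. \<Sum>D2\<in>?P ` A. \<bar>inner_pmf ?D (rel_dev D1 ?D) (rel_dev D2 ?D)\<bar>)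
      = (\<Sum>S\<in>A. \<Sum>T\<in>A. \<bar>inner_pmf ?D (rel_dev (?P S) ?D) (rel_dev (?P T) ?D)\<bar>)"
    using inj by (simp add: sum.reindex)
  also have "\<dots> = (\<Sum>S\<in>A. \<Sum>T\<in>A. ?r * (c ^ card (S \<inter> T) - 1))"
  proof (intro sum.cong refl)
    fix S T assume "S \<in> A" "T \<in> A"
    then have "S \<subseteq> {1..n}" using A by (auto simp: ksubsets_def)
    then have "inner_pmf ?D (rel_dev (?P S) ?D) (rel_dev (?P T) ?D)
        = ?r * (c ^ card (S \<inter> T) - 1)"
      unfolding c_def using pq q1 k by (intro inner_pmf_planted_dist) auto
    \<comment> \<open>As \<open>c > 1\<close>, no correlation is negative and the absolute values
      disappear.\<close>
    moreover have "?r * (c ^ card (S \<inter> T) - 1) \<ge> 0"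
      using one_le_power[of c "card (S \<inter> T)"] c1 by (intro mult_nonneg_nonneg) auto
    ultimately show "\<bar>inner_pmf ?D (rel_dev (?P S) ?D) (rel_dev (?P T) ?D)\<bar>
        = ?r * (c ^ card (S \<inter> T) - 1)"
      by (simp only: abs_of_nonneg)
  qed
  also have "\<dots> = ?r * (\<Sum>S\<in>A. \<Sum>T\<in>A. c ^ card (S \<inter> T) - 1)"
    by (simp only: sum_distrib_left)
  also have "\<dots> < ?r * (\<Sum>S\<in>A. 2 * (c ^ (l + 1) - 1) * card A)"
    using r row finA A(2) by (intro mult_strict_left_mono sum_strict_mono) auto
  also have "\<dots> = 2 * (real k)\<^sup>2 / (real n)\<^sup>2 * (c ^ (l + 1) - 1) * (real (card A))\<^sup>2"
    by (simp add: power2_eq_square)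
  finally show ?thesis
    using cardA inj by (simp add: avg_corr_def card_image divide_less_eq mult_ac)
qed

text \<open>The witnesses are \<open>null_dist\<close> and the family of all planted distributions.
  A solution excludes exactly one of its members, so the size condition holds with equality.\<close>

lemma sda_bound_planted_bds:
  fixes p q c N :: real and n k l d :: nat
  defines "c \<equiv> 1 + (p - q)\<^sup>2 / (q * (1 - q))"
  assumes pq: "0 < q" "q < p" "p \<le> 1" and k: "1 \<le> k" "k < n"
    and cN: "c \<le> N" and kN: "(real k)\<^sup>2 * N \<le> real n"
    and d: "1 \<le> d" "real d \<le> N ^ l"
  shows "sda_bound (planted_bds n k p q)
           (2 * (real k)\<^sup>2 / (real n)\<^sup>2 * (c ^ (l + 1) - 1)) (1 / real (n choose k)) d"
  unfolding sda_bound_def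
proof (intro exI conjI ballI allI impI)
  let ?P = "planted_dist n k p q" and ?D = "null_dist n q"
  let ?Z = "planted_bds n k p q"
  let ?DD = "?P ` ksubsets n k"
  have q: "0 < q" "q < 1" using pq by auto
  have inj: "inj_on ?P (ksubsets n k)"
    using inj_on_planted_dist[of k q p n] pq k by auto
  have cardDD: "card ?DD = n choose k"
    using inj by (simp add: card_image card_ksubsets)
  \<comment> \<open>A second \<open>k\<close>-subset keeps the family nonempty after the exclusion,
    so the size threshold for \<open>D'\<close> is positive and rules out the empty set.\<close>
  have m: "1 < n choose k"
  proof -
    have "1 < (real n / real k) ^ k"
      using k by (intro one_less_power) auto
    also have "\<dots> \<le> real (n choose k)"
      using k by (intro binomial_ge_n_over_k_pow_k) auto
    finally show ?thesis by simp
  qed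
  show "set_pmf ?D \<subseteq> sp_domain ?Z"
    using q by (simp add: set_pmf_null_dist planted_bds_def)
  show "finite ?DD"
    using finite_ksubsets by simp
  show "?DD \<noteq> {}"
    using m cardDD by (metis card.empty not_less_zero)
  show "?DD \<subseteq> sp_dists ?Z"
    by (simp add: planted_bds_def)
  show "set_pmf D1 \<subseteq> set_pmf ?D" if "D1 \<in> ?DD" for D1
    using that q set_pmf_planted_dist[of n k p q] by (auto simp: set_pmf_null_dist)
  fix S assume "S \<in> sp_solutions ?Z"
  then have S: "S \<in> ksubsets n k"
    by (simp add: planted_bds_def)
  have rest: "?DD - sp_preimage ?Z S = ?P ` (ksubsets n k - {S})"
    using S inj by (simp add: sp_preimage_planted_bds inj_on_image_set_diff[OF inj])
  have card_rest: "card (?DD - sp_preimage ?Z S) = (n choose k) - 1"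
    using S cardDD finite_ksubsets by (simp add: sp_preimage_planted_bds)
  show "(1 - 1 / real (n choose k)) * real (card ?DD) \<le> real (card (?DD - sp_preimage ?Z S))"
    using m k unfolding card_rest cardDD by (simp add: of_nat_diff field_simps)
  fix D'
  assume D': "D' \<subseteq> ?DD - sp_preimage ?Z S"
    and large: "real (card (?DD - sp_preimage ?Z S)) / real d \<le> real (card D')"
  obtain A where A: "A \<subseteq> ksubsets n k" "D' = ?P ` A"
    using D' by (metis Diff_subset subset_image_iff subset_trans)
  have cardA: "card D' = card A"
    unfolding A(2) using inj A(1) by (intro card_image) (rule inj_on_subset)
  have "0 < real ((n choose k) - 1) / real d"
    using m d by simp
  also note large[unfolded card_rest cardA]
  finally have "A \<noteq> {}"
    by auto
  then show "avg_corr D' ?D < 2 * (real k)\<^sup>2 / (real n)\<^sup>2 * (c ^ (l + 1) - 1)"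
    unfolding A(2) c_def
    using A(1) large[unfolded card_rest cardA] pq k cN kN d
    by (intro avg_corr_planted_dist_less) (auto simp: c_def)
qed

theorem theorem5p7:
  fixes p q \<delta> :: real and n k l :: nat
  assumes "0 < q" and "q < p" and "p \<le> 1"
    and "0 < \<delta>"
    and "1 \<le> k" and "real k \<le> real n powr (1 / 2 - \<delta>)"
    and "l \<le> k"
    and "real n powr (2 * \<delta>) \<ge> 1 + (p - q)\<^sup>2 / (q * (1 - q))"
  shows "ereal_of_enat
           (SDA (planted_bds n k p q)
              (2 * (real k)\<^sup>2 / (real n)\<^sup>2 *
                 ((1 + (p - q)\<^sup>2 / (q * (1 - q))) ^ (l + 1) - 1))
              (1 / real (n choose k)))
         \<ge> ereal (real n powr (2 * real l * \<delta>) / 4)"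
proof -
  define N where "N = real n powr (2 * \<delta>)"
  \<comment> \<open>Since \<open>N ^ l \<ge> 1\<close>, rounding down loses less than half, well
    within the factor 4 of the claim.\<close>
  define d where "d = nat \<lfloor>N ^ l\<rfloor>"
  let ?\<gamma> = "2 * (real k)\<^sup>2 / (real n)\<^sup>2 * ((1 + (p - q)\<^sup>2 / (q * (1 - q))) ^ (l + 1) - 1)"
  let ?\<eta> = "1 / real (n choose k)"
  have n: "n > 0"
    using assms(5,6) by (cases n) auto
  have "(p - q)\<^sup>2 / (q * (1 - q)) > 0"
    using assms(1-3) by simp
  then have N: "N > 1"
    using assms(8) unfolding N_def by linarith
  \<comment> \<open>Squaring gives the exponent \<open>1 - 2 * \<delta>\<close>, complementary to
    that of \<open>N\<close>.\<close>
  have "(real k)\<^sup>2 \<le> (real n powr (1 / 2 - \<delta>))\<^sup>2"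
    using assms(6) by (intro power_mono) auto
  also have "\<dots> = real n powr (1 - 2 * \<delta>)"
    using n by (simp add: power2_eq_square powr_add[symmetric])
  finally have "(real k)\<^sup>2 * N \<le> real n powr (1 - 2 * \<delta>) * N"
    using N by (intro mult_right_mono) auto
  also have "\<dots> = real n"
    using n by (simp add: N_def powr_add[symmetric])
  finally have kN: "(real k)\<^sup>2 * N \<le> real n" .
  have "real k \<le> (real k)\<^sup>2"
    using assms(5) by (simp add: power2_eq_square)
  also have "\<dots> < (real k)\<^sup>2 * N"
    using assms(5) N by simp
  finally have kn: "k < n"
    using kN by simp
  have "1 \<le> N ^ l"
    using N by (intro one_le_power) simp
  moreover from this have "1 \<le> \<lfloor>N ^ l\<rfloor>" by simp
  ultimately have d: "1 \<le> d" "real d \<le> N ^ l" "N ^ l / 4 \<le> real d"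
    unfolding d_def by linarith+
  have "sda_bound (planted_bds n k p q) ?\<gamma> ?\<eta> d"
    using assms kn kN d by (intro sda_bound_planted_bds) (auto simp: N_def)
  then have "enat d \<le> SDA (planted_bds n k p q) ?\<gamma> ?\<eta>"
    unfolding SDA_def using d(1) by (intro Sup_upper) auto
  then have "ereal (real d) \<le> ereal_of_enat (SDA (planted_bds n k p q) ?\<gamma> ?\<eta>)"
    by (metis ereal_of_enat_le_iff ereal_of_enat_simps(1))
  moreover have "real n powr (2 * real l * \<delta>) = N ^ l"
    using n by (simp add: N_def powr_power mult_ac)
  ultimately show ?thesis
    using d(3) by (metis ereal_less_eq(3) order_trans)
qed

end
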